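(* The map $\pi^{\mathrm I}:O(n)\to\mathcal{F}^{\mathrm I}$, $\pi^{\mathrm I}(Q)=(QP_0^iQ^T)_{1\le i\le r}$, and its restriction $\pi_0^{\mathrm I}$ to $SO(n)$ are surjective.
   Context: A type is $\mathrm I=(q_i)_{1\le i\le r}$, $r\ge2$, of positive integers with $\sum_iq_i=n$. $\mathcal{F}^{\mathrm I}$ is the set of tuples $(P_i)_{1\le i\le r}$ of real $n\times n$ matrices with $P_i^2=P_i=P_i^T$, $\mathrm{rank}(P_i)=q_i$, and $P_iP_j=0$ for $i\ne j$. $P_0^i=\mathrm{Diag}[0_{q_1},\dots,I_{q_i},\dots,0_{q_r}]$ is the block diagonal matrix with identity in the $i$-th block and zeros elsewhere; $(P_0^i)_i\in\mathcal{F}^{\mathrm I}$ is the standard flag. *)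

theory Defs
  imports "Jordan_Normal_Form.DL_Rank"
begin

definition flag_type :: "nat \<Rightarrow> nat list \<Rightarrow> bool" where
  "flag_type n q \<longleftrightarrow> 2 \<le> length q \<and> (\<forall>i<length q. 0 < q ! i) \<and> sum_list q = n"

text \<open>Tuples indexed by \<open>1 \<le> i \<le> r\<close> are lists of length \<open>r\<close>, indexed from \<open>0\<close>.\<close>

definition flags :: "nat \<Rightarrow> nat list \<Rightarrow> real mat list set" where
  "flags n q = {P. length P = length q \<and>
     (\<forall>i<length q. P ! i \<in> carrier_mat n n \<and>
        P ! i * P ! i = P ! i \<and> transpose_mat (P ! i) = P ! i \<and>
        vec_space.rank n (P ! i) = q ! i) \<and>
     (\<forall>i<length q. \<forall>j<length q. i \<noteq> j \<longrightarrow> P ! i * P ! j = 0\<^sub>m n n)}"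

definition orthogonal_group :: "nat \<Rightarrow> real mat set" where
  "orthogonal_group n = {Q \<in> carrier_mat n n.
     transpose_mat Q * Q = 1\<^sub>m n \<and> Q * transpose_mat Q = 1\<^sub>m n}"

definition special_orthogonal_group :: "nat \<Rightarrow> real mat set" where
  "special_orthogonal_group n = {Q \<in> orthogonal_group n. det Q = 1}"

definition standard_proj :: "nat list \<Rightarrow> nat \<Rightarrow> real mat" where
  "standard_proj q i = diag_block_mat
     (map (\<lambda>j. if j = i then 1\<^sub>m (q ! j) else 0\<^sub>m (q ! j) (q ! j)) [0..<length q])"

definition flag_map :: "nat list \<Rightarrow> real mat \<Rightarrow> real mat list" where
  "flag_map q Q = map (\<lambda>i. Q * standard_proj q i * transpose_mat Q) [0..<length q]"

end

theory Submission
  imports Defs "Jordan_Normal_Form.Gram_Schmidt"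
begin

(* An orthogonal projection has an orthonormal basis of its column space as a list of rank many
   vectors, all fixed by the projection.  Since P_i P_j = 0, the concatenation of these lists over
   the members of a flag is orthonormal, and since the ranks add up to n it consists of the columns
   of an orthogonal matrix Q.  Comparing columns gives P_i Q = Q P_0^i.  If det Q = -1, negating the
   first column of Q corrects the determinant without changing any Q P_0^i Q^T. *)

section \<open>Column spaces and rank\<close>

lemma set_cols_carrier_vec:
  assumes "A \<in> carrier_mat n nc"
  shows "set (cols A) \<subseteq> carrier_vec n"
  using cols_dim[of A] assms by auto

context vec_space
begin

text \<open>Products \<open>A *\<^sub>v v\<close> suit equations such as \<open>P * P = P\<close>,
  while rank theory speaks of spans of columns; this passes between the two.\<close>

lemma span_cols_eq_range:
  assumes "A \<in> carrier_mat n nc"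
  shows "span (set (cols A)) = (\<lambda>v. A *\<^sub>v v) ` carrier_vec nc"
proof -
  have dims: "\<forall>w\<in>set (cols A). dim_vec w = n"
    using set_cols_carrier_vec[OF assms] by auto
  have A: "mat_of_cols n (cols A) = A" "length (cols A) = nc"
    using assms by auto
  have "span (set (cols A)) = span_list (cols A)"
    by (rule span_list_as_span[OF set_cols_carrier_vec[OF assms], symmetric])
  also have "\<dots> = range (\<lambda>c. A *\<^sub>v vec nc c)"
    unfolding span_list_def using lincomb_list_as_mat_mult[OF dims] A by auto
  also have "\<dots> = (\<lambda>v. A *\<^sub>v v) ` carrier_vec nc"
  proof -
    have "carrier_vec nc = range (vec nc :: (nat \<Rightarrow> 'a) \<Rightarrow> 'a vec)"
    proof (intro equalityI subsetI)
      fix v :: "'a vec" assume "v \<in> carrier_vec nc"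
      then have "v = vec nc (\<lambda>i. v $ i)" by auto
      then show "v \<in> range (vec nc)" by blast
    qed auto
    then show ?thesis by (simp add: image_image)
  qed
  finally show ?thesis .
qed

text \<open>The set \<open>S\<close> may contain vectors that are not columns of \<open>A\<close>.
  The two inclusions make the spans equal, and an independent \<open>S\<close> is a maximal
  independent subset of itself, so its cardinality is the dimension of the column space.\<close>

lemma rank_eq_card_spanning:
  assumes A: "A \<in> carrier_mat n nc"
    and S: "finite S" "lin_indpt S" "S \<subseteq> span (set (cols A))" "set (cols A) \<subseteq> span S"
  shows "rank A = card S"
proof -
  have cA: "set (cols A) \<subseteq> carrier_vec n"
    by (rule set_cols_carrier_vec[OF A])
  have cS: "S \<subseteq> carrier_vec n"
    using S(3) span_is_subset2[OF cA] by blast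
  have "span S = span (set (cols A))"
    using span_subsetI[OF cA S(3)] span_subsetI[OF cS S(4)] by blast
  moreover have "maximal S (\<lambda>T. T \<subseteq> S \<and> lin_indpt T)"
    using S(2) by (auto simp: maximal_def)
  ultimately show ?thesis
    unfolding rank_def using dim_span[of S S] cS S(1) by simp
qed

lemma det_nonzero_cols:
  assumes "A \<in> carrier_mat n n" "det A \<noteq> 0"
  shows "distinct (cols A)" "lin_indpt (set (cols A))"
  using assms non_distinct_low_rank[OF assms(1)] det_rank_iff[OF assms(1)]
    lin_dep_cols_imp_det_0[OF assms(1)] by auto

text \<open>The product is the combination of the columns with the entries of \<open>v\<close> as
  coefficients, and the columns outside \<open>K\<close> contribute nothing.\<close>

lemma mult_vec_in_span_cols:
  assumes A: "A \<in> carrier_mat n nc" "distinct (cols A)" and v: "v \<in> carrier_vec nc"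
    and supp: "\<And>k. k < nc \<Longrightarrow> k \<notin> K \<Longrightarrow> v $ k = 0" and K: "K \<subseteq> {..<nc}"
  shows "A *\<^sub>v v \<in> span (col A ` K)"
proof -
  \<comment> \<open>\<open>lincomb\<close> takes coefficients indexed by vectors, not positions.
    Since the columns are distinct, \<open>find_first\<close> recovers the position of a
    column.\<close>
  let ?a = "\<lambda>u. v $ find_first u (cols A)"
  let ?Z = "col A ` ({..<nc} - K)"
  have cols: "set (cols A) = col A ` K \<union> ?Z"
    using A(1) K by (auto simp: cols_def)
  have carr: "col A ` K \<subseteq> carrier_vec n" "?Z \<subseteq> carrier_vec n"
    using A(1) by auto
  have "?a \<in> ?Z \<rightarrow> {0}"
  proof
    fix u assume "u \<in> ?Z"
    then obtain k where k: "k < nc" "k \<notin> K" "u = cols A ! k"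
      using A(1) by auto
    then have "find_first u (cols A) = k"
      using find_first_unique[OF A(2), of k] A(1) by simp
    with k supp show "?a u \<in> {0}" by simp
  qed
  then have "lincomb ?a (set (cols A)) = lincomb ?a (col A ` K)"
    unfolding cols using carr K finite_subset[OF K]
    by (intro lincomb_clean) (auto simp: class_ring_simps)
  then have "A *\<^sub>v v = lincomb ?a (col A ` K)"
    using lincomb_eq_mat_mult[OF A(1) v A(2)] by simp
  then show ?thesis
    using finite_subset[OF K] by (intro in_spanI) auto
qed

end

section \<open>Orthonormal lists\<close>

definition orthonormal :: "real vec list \<Rightarrow> bool" where
  "orthonormal us \<longleftrightarrow> distinct us \<and> (\<forall>u\<in>set us. \<forall>v\<in>set us. u \<bullet> v = (if u = v then 1 else 0))"

lemma scalar_prod_self_pos: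
  fixes w :: "real vec"
  assumes "w \<bullet> w \<noteq> 0"
  shows "w \<bullet> w > 0"
  using assms by (simp add: scalar_prod_def order.strict_iff_order sum_nonneg)

text \<open>Gram-Schmidt is applied to a maximal independent set of columns and the result is
  normalised. The vectors are located in the range of \<open>A\<close> so that, for an idempotent
  \<open>A\<close>, they turn out to be fixed by \<open>A\<close>.\<close>

lemma orthonormal_list_in_span_cols:
  fixes A :: "real mat"
  assumes A: "A \<in> carrier_mat n nc"
  obtains us where "length us = vec_space.rank n A" "orthonormal us"
    "set us \<subseteq> (\<lambda>v. A *\<^sub>v v) ` carrier_vec nc"
proof -
  interpret cof_vec_space n "TYPE(real)" .
  have cA: "set (cols A) \<subseteq> carrier_vec n"
    by (rule set_cols_carrier_vec[OF A])
  obtain S where S: "maximal S (\<lambda>T. T \<subseteq> set (cols A) \<and> lin_indpt T)" "finite S"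
    using maximal_exists_superset[of "set (cols A)" "\<lambda>T. T \<subseteq> set (cols A) \<and> lin_indpt T" "{}"]
    by (auto simp: lin_dep_def)
  have card: "rank A = card S" by (rule rank_card_indpt[OF A S(1)])
  have li: "S \<subseteq> set (cols A)" "lin_indpt S" using S(1) by (auto simp: maximal_def)
  obtain ws0 where ws0: "set ws0 = S" "distinct ws0" using finite_distinct_list[OF S(2)] by blast
  define ws where "ws = gram_schmidt n ws0"
  have ws0_carr: "set ws0 \<subseteq> carrier_vec n" using ws0 li cA by auto
  have lin: "\<not> lin_dep (set ws0)" using ws0 li by simp
  note gs = gram_schmidt_result[OF ws0_carr ws0(2) lin ws_def]
  have orth: "ws ! i \<bullet> ws ! j = 0 \<longleftrightarrow> i \<noteq> j" if "i < length ws" "j < length ws" for i j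
  proof -
    \<comment> \<open>Gram-Schmidt orthogonality is stated for the conjugate scalar product, which
      over the reals is the ordinary one. The case \<open>i = j\<close> of the equivalence also says
      that no \<open>ws ! i\<close> has norm zero, which makes the division in \<open>c\<close>
      legitimate.\<close>
    have "conjugate (ws ! j) = ws ! j" by (intro eq_vecI) auto
    then show ?thesis using corthogonalD[OF gs(2) that] by simp
  qed
  define c where "c w = 1 / sqrt (w \<bullet> w)" for w :: "real vec"
  define us where "us = map (\<lambda>w. c w \<cdot>\<^sub>v w) ws"
  have wc: "ws ! i \<in> carrier_vec n" if "i < length ws" for i using gs(3) that by auto
  have prod: "us ! i \<bullet> us ! j = (if i = j then 1 else 0)" if ij: "i < length us" "j < length us" for i j
  proof -
    have ij': "i < length ws" "j < length ws" using ij by (auto simp: us_def)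
    have "us ! i \<bullet> us ! j = c (ws ! i) * (c (ws ! j) * (ws ! i \<bullet> ws ! j))"
      using wc[OF ij'(1)] wc[OF ij'(2)] ij' by (simp add: us_def)
    moreover have "c (ws ! i) * (c (ws ! i) * (ws ! i \<bullet> ws ! i)) = 1"
      using orth[OF ij'(1) ij'(1)] scalar_prod_self_pos[of "ws ! i"] by (simp add: c_def)
    ultimately show ?thesis using orth[OF ij'] by auto
  qed
  \<comment> \<open>Equal vectors at two different positions would have scalar product both 0 and
    1.\<close>
  have dist: "distinct us"
    unfolding distinct_conv_nth by (metis prod zero_neq_one)
  have "orthonormal us"
    unfolding orthonormal_def using dist
    by (auto simp: in_set_conv_nth prod nth_eq_iff_index_eq)
  moreover have "length us = rank A"
    using gs(4) ws0 distinct_card[OF ws0(2)] card by (simp add: us_def)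
  moreover have "set us \<subseteq> (\<lambda>v. A *\<^sub>v v) ` carrier_vec nc"
  proof -
    have "set ws \<subseteq> span (set (cols A))"
      using gs(1) gs(3) ws0(1) li(1) span_is_monotone[OF li(1)] in_own_span[of "set ws"] by auto
    then show ?thesis
      unfolding span_cols_eq_range[OF A, symmetric] us_def
      by (auto intro!: smult_in_span[OF cA])
  qed
  ultimately show ?thesis by (intro that)
qed

section \<open>Orthogonal matrices and conjugated diagonal projections\<close>

lemma orthonormal_mat_of_cols:
  assumes "orthonormal us" "set us \<subseteq> carrier_vec n"
  shows "transpose_mat (mat_of_cols n us) * mat_of_cols n us = 1\<^sub>m (length us)"
  using assms by (intro eq_matI) (auto simp: orthonormal_def nth_eq_iff_index_eq subset_iff)

text \<open>For square matrices a one-sided inverse is two-sided.\<close>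

lemma orthogonal_groupI:
  assumes Q: "Q \<in> carrier_mat n n" and "transpose_mat Q * Q = 1\<^sub>m n"
  shows "Q \<in> orthogonal_group n"
  using assms mat_mult_left_right_inverse[of "transpose_mat Q" n Q]
  by (simp add: orthogonal_group_def)

lemma det_orthogonal_group:
  assumes "Q \<in> orthogonal_group n"
  shows "det Q = 1 \<or> det Q = - 1"
proof -
  have "det Q * det Q = det (transpose_mat Q * Q)"
    using assms det_mult[of "transpose_mat Q" n Q] det_transpose[of Q n]
    by (simp add: orthogonal_group_def)
  also have "\<dots> = 1" using assms by (simp add: orthogonal_group_def)
  finally show ?thesis by (simp add: square_eq_1_iff)
qed

text \<open>Serves to cancel \<open>transpose_mat Q * Q\<close>, or the square of a sign matrix,
  inside a product of conjugates.\<close>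

lemma mult_cancel_middle:
  fixes A B C D :: "'a :: semiring_1 mat"
  assumes "A \<in> carrier_mat n n" "B \<in> carrier_mat n n" "C \<in> carrier_mat n n" "D \<in> carrier_mat n n"
    and "B * C = 1\<^sub>m n"
  shows "(A * B) * (C * D) = A * D"
proof -
  have "(A * B) * (C * D) = A * (B * C * D)"
    using assms assoc_mult_mat[of A n n B n "C * D" n] assoc_mult_mat[of B n n C n D n] by simp
  then show ?thesis using assms left_mult_one_mat[of D n n] by simp
qed

lemma transpose_mat_diag [simp]: "transpose_mat (mat_diag n f) = mat_diag n f"
  by (intro eq_matI) (auto simp: mat_diag_def)

text \<open>Write \<open>A\<close> for the conjugate. From \<open>A * Q = Q * D\<close>,
  \<open>A\<close> fixes the columns of \<open>Q\<close> with index in \<open>K\<close>, so they lie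
  in its range; conversely \<open>D\<close> kills all other coordinates, so the range lies in their
  span. They are independent because \<open>det Q\<close> is nonzero.\<close>

lemma rank_conj_mat_diag:
  assumes Q: "Q \<in> orthogonal_group n" and K: "K \<subseteq> {..<n}"
  defines "D \<equiv> mat_diag n (\<lambda>k. if k \<in> K then 1 else 0)"
  shows "vec_space.rank n (Q * D * transpose_mat Q) = card K"
proof -
  interpret vec_space "TYPE(real)" n .
  define A where "A = Q * D * transpose_mat Q"
  have Qc: "Q \<in> carrier_mat n n" "transpose_mat Q \<in> carrier_mat n n"
    and QQ: "transpose_mat Q * Q = 1\<^sub>m n"
    using Q by (auto simp: orthogonal_group_def)
  have Dc: "D \<in> carrier_mat n n" by (simp add: D_def)
  have Ac: "A \<in> carrier_mat n n" using Qc Dc by (auto simp: A_def)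
  have "det Q \<noteq> 0" using det_orthogonal_group[OF Q] by auto
  note Qcols = det_nonzero_cols[OF Qc(1) this]
  have colset: "col Q ` K \<subseteq> set (cols Q)" using K Qc by (auto simp: cols_def)
  have inj: "inj_on (col Q) K"
    using Qcols(1) Qc(1) inj_on_subset[OF _ K, of "col Q"]
    by (simp add: cols_def distinct_map atLeast0LessThan)
  have "A * Q = Q * D"
    using QQ Qc Dc by (simp add: A_def assoc_mult_mat[of _ n n _ n _ n])
  then have fix_col: "A *\<^sub>v col Q k = col Q k" if "k \<in> K" for k
  proof -
    have k: "k < n" using that K by auto
    have "A *\<^sub>v col Q k = col (A * Q) k"
      using Ac Qc k by (intro eq_vecI) auto
    also have "\<dots> = col Q k"
      unfolding \<open>A * Q = Q * D\<close> D_def mat_diag_mult_right[OF Qc(1)]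
      using k Qc that by (intro eq_vecI) auto
    finally show ?thesis .
  qed
  have "rank A = card (col Q ` K)"
  proof (rule rank_eq_card_spanning[OF Ac])
    show "finite (col Q ` K)" using K finite_subset by blast
    show "lin_indpt (col Q ` K)" using subset_li_is_li[OF Qcols(2) colset] .
    show "col Q ` K \<subseteq> span (set (cols A))"
      unfolding span_cols_eq_range[OF Ac]
    proof
      fix u assume "u \<in> col Q ` K"
      then obtain k where "k \<in> K" "u = col Q k" by blast
      then show "u \<in> (\<lambda>v. A *\<^sub>v v) ` carrier_vec n"
        using fix_col[of k] Qc(1) by (metis col_carrier_vec K lessThan_iff subsetD carrier_matD(2) image_eqI)
    qed
    show "set (cols A) \<subseteq> span (col Q ` K)"
    proof
      fix u assume "u \<in> set (cols A)"
      then have "u \<in> span (set (cols A))"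
        using in_own_span[of "set (cols A)"] set_cols_carrier_vec[OF Ac] by auto
      then obtain v where v: "v \<in> carrier_vec n" "u = A *\<^sub>v v"
        unfolding span_cols_eq_range[OF Ac] by blast
      \<comment> \<open>The coordinates of \<open>v\<close> in the basis of columns of
        \<open>Q\<close>, cut down to \<open>K\<close> by \<open>D\<close>.\<close>
      define y where "y = D *\<^sub>v (transpose_mat Q *\<^sub>v v)"
      have w: "transpose_mat Q *\<^sub>v v \<in> carrier_vec n" using Qc v by auto
      have "u = Q *\<^sub>v y"
        unfolding y_def v(2) A_def using Qc Dc v(1) w
        by (simp add: assoc_mult_mat_vec[of _ n n _ n])
      moreover have "Q *\<^sub>v y \<in> span (col Q ` K)"
      proof (rule mult_vec_in_span_cols[OF Qc(1) Qcols(1) _ _ K])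
        show "y \<in> carrier_vec n" using Dc w by (auto simp: y_def)
        show "y $ k = 0" if "k < n" "k \<notin> K" for k
        proof -
          have "(D *\<^sub>v x) $ k = 0" if "x \<in> carrier_vec n" for x
            using that \<open>k < n\<close> \<open>k \<notin> K\<close>
            by (auto simp: D_def mat_diag_def scalar_prod_def intro!: sum.neutral)
          then show ?thesis using w by (simp add: y_def)
        qed
      qed
      ultimately show "u \<in> span (col Q ` K)" by simp
    qed
  qed
  then show ?thesis using card_image[OF inj] by (simp add: A_def)
qed

section \<open>The standard flag as diagonal matrices\<close>

text \<open>Labels each diagonal position with the block containing it, so that no partial sums of
  \<open>q\<close> have to be computed. The shape matches a concatenation of bases, one for each
  block.\<close>

definition block_of :: "nat list \<Rightarrow> nat list" where
  "block_of q = concat (map (\<lambda>j. replicate (q ! j) j) [0..<length q])"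

definition block_set :: "nat list \<Rightarrow> nat \<Rightarrow> nat set" where
  "block_set q i = {k. k < sum_list q \<and> block_of q ! k = i}"

lemma length_block_of: "length (block_of q) = sum_list q"
  by (simp add: block_of_def length_concat comp_def map_nth)

lemma block_set_subset: "block_set q i \<subseteq> {..<sum_list q}"
  by (auto simp: block_set_def)

text \<open>Counts the positions labelled \<open>i\<close>. An arbitrary distinct index list makes
  induction possible: once \<open>i\<close> has been met at the head, the tail contributes
  nothing.\<close>

lemma filter_eq_concat_replicate:
  assumes "distinct js" "i \<in> set js"
  shows "filter (\<lambda>x. x = i) (concat (map (\<lambda>j. replicate (m j) j) js)) = replicate (m i) i"
proof -
  have none: "filter (\<lambda>x. x = i) (concat (map (\<lambda>j. replicate (m j) j) ks)) = []"
    if "i \<notin> set ks" for ks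
    using that by (auto simp: filter_empty_conv)
  show ?thesis using assms by (induction js) (auto simp: none filter_replicate)
qed

lemma card_block_set:
  assumes "i < length q"
  shows "card (block_set q i) = q ! i"
proof -
  have "card (block_set q i) = length (filter (\<lambda>x. x = i) (block_of q))"
    by (simp add: block_set_def length_filter_conv_card length_block_of)
  then show ?thesis
    using filter_eq_concat_replicate[of "[0..<length q]" i] assms by (simp add: block_of_def)
qed

text \<open>The induction splits off the first block. With a general list \<open>js\<close> in place
  of \<open>[0..<length q]\<close>, the remaining blocks keep their labels.\<close>

lemma diag_block_mat_eq_mat_diag:
  "diag_block_mat (map (\<lambda>j. if j = i then 1\<^sub>m (m j) else 0\<^sub>m (m j) (m j)) js) =
    (mat_diag (\<Sum>j\<leftarrow>js. m j) (\<lambda>k. if concat (map (\<lambda>j. replicate (m j) j) js) ! k = i then 1 else 0)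
      :: 'a :: {zero, one} mat)"
proof (induction js)
  case Nil
  show ?case by (intro eq_matI) (auto simp: mat_diag_def)
next
  case (Cons j js)
  show ?case
    by (intro eq_matI) (auto simp: Cons mat_diag_def Let_def nth_append)
qed

lemma standard_proj_eq_mat_diag:
  "standard_proj q i = mat_diag (sum_list q) (\<lambda>k. if k \<in> block_set q i then 1 else 0)"
proof -
  have "standard_proj q i = mat_diag (sum_list q) (\<lambda>k. if block_of q ! k = i then 1 else 0)"
    unfolding standard_proj_def diag_block_mat_eq_mat_diag
    by (simp add: block_of_def map_nth)
  also have "\<dots> = mat_diag (sum_list q) (\<lambda>k. if k \<in> block_set q i then 1 else 0)"
    by (intro eq_matI) (auto simp: mat_diag_def block_set_def)
  finally show ?thesis .
qed

lemma standard_proj_carrier [simp]: "standard_proj q i \<in> carrier_mat (sum_list q) (sum_list q)"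
  by (simp add: standard_proj_eq_mat_diag)

lemma standard_proj_mult:
  "standard_proj q i * standard_proj q j =
    (if i = j then standard_proj q i else 0\<^sub>m (sum_list q) (sum_list q))"
  unfolding standard_proj_eq_mat_diag mat_diag_diag
  by (intro eq_matI) (auto simp: mat_diag_def block_set_def)

section \<open>Surjectivity\<close>

text \<open>Conjugation by \<open>Q\<close> preserves products because
  \<open>transpose_mat Q * Q\<close> is the identity, so the relations among the standard
  projections carry over; the ranks come from \<open>rank_conj_mat_diag\<close>.\<close>

lemma flag_map_mem_flags:
  assumes q: "sum_list q = n" and Q: "Q \<in> orthogonal_group n"
  shows "flag_map q Q \<in> flags n q"
proof -
  let ?P = "\<lambda>i. Q * standard_proj q i * transpose_mat Q"
  have Qc: "Q \<in> carrier_mat n n" "transpose_mat Q \<in> carrier_mat n n"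
    and QQ: "transpose_mat Q * Q = 1\<^sub>m n"
    using Q by (auto simp: orthogonal_group_def)
  have Sc: "standard_proj q i \<in> carrier_mat n n" for i using q by auto
  have St: "transpose_mat (standard_proj q i) = standard_proj q i" for i
    by (simp add: standard_proj_eq_mat_diag)
  have prod: "?P i * ?P j = Q * (standard_proj q i * standard_proj q j) * transpose_mat Q" for i j
  proof -
    have "?P i * ?P j = ?P i * (Q * (standard_proj q j * transpose_mat Q))"
      using assoc_mult_mat[OF Qc(1) Sc Qc(2)] by simp
    also have "\<dots> = (Q * standard_proj q i) * (standard_proj q j * transpose_mat Q)"
      using Qc QQ mult_carrier_mat[OF Qc(1) Sc] mult_carrier_mat[OF Sc Qc(2)]
      by (intro mult_cancel_middle)
    also have "\<dots> = Q * (standard_proj q i * standard_proj q j) * transpose_mat Q"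
      using assoc_mult_mat[OF Qc(1) Sc mult_carrier_mat[OF Sc Qc(2)]]
        assoc_mult_mat[OF Qc(1) mult_carrier_mat[OF Sc Sc] Qc(2)] assoc_mult_mat[OF Sc Sc Qc(2)]
      by simp
    finally show ?thesis .
  qed
  have "transpose_mat (?P i) = ?P i" for i
    using Qc Sc[of i] St[of i]
    by (simp add: transpose_mult[of _ n n _ n] assoc_mult_mat[of _ n n _ n _ n])
  moreover have "vec_space.rank n (?P i) = q ! i" if "i < length q" for i
    using rank_conj_mat_diag[OF Q, of "block_set q i"] block_set_subset[of q i]
      card_block_set[OF that] q
    by (simp add: standard_proj_eq_mat_diag)
  moreover have "?P i \<in> carrier_mat n n" for i using Qc Sc by auto
  moreover have "?P i * ?P i = ?P i" for i
    by (simp add: prod standard_proj_mult)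
  moreover have "?P i * ?P j = 0\<^sub>m n n" if "i \<noteq> j" for i j
    using that Qc q by (simp add: prod standard_proj_mult)
  ultimately show ?thesis by (simp add: flags_def flag_map_def)
qed

section \<open>Orthonormal bases adapted to a flag\<close>

lemma orthonormal_concat:
  assumes "\<And>us. us \<in> set uss \<Longrightarrow> orthonormal us"
    and "\<And>i j u v. i < length uss \<Longrightarrow> j < length uss \<Longrightarrow> i \<noteq> j \<Longrightarrow>
      u \<in> set (uss ! i) \<Longrightarrow> v \<in> set (uss ! j) \<Longrightarrow> u \<bullet> v = 0"
  shows "orthonormal (concat uss)"
  using assms
proof (induction uss)
  case Nil
  show ?case by (simp add: orthonormal_def)
next
  case (Cons us uss)
  have IH: "orthonormal (concat uss)"
  proof (rule Cons.IH)
    show "orthonormal vs" if "vs \<in> set uss" for vs using Cons.prems(1) that by simp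
    show "u \<bullet> v = 0" if "i < length uss" "j < length uss" "i \<noteq> j"
      "u \<in> set (uss ! i)" "v \<in> set (uss ! j)" for i j u v
      using Cons.prems(2)[of "Suc i" "Suc j" u v] that by simp
  qed
  have us: "orthonormal us" using Cons.prems(1) by simp
  have cross: "u \<bullet> v = 0" "v \<bullet> u = 0" if uv: "u \<in> set us" "v \<in> set (concat uss)" for u v
  proof -
    obtain j where j: "j < length uss" "v \<in> set (uss ! j)"
      using uv(2) by (auto simp: in_set_conv_nth[of _ uss])
    show "u \<bullet> v = 0" "v \<bullet> u = 0"
      using Cons.prems(2)[of 0 "Suc j" u v] Cons.prems(2)[of "Suc j" 0 v u] j uv(1) by simp_all
  qed
  \<comment> \<open>A common vector would be orthogonal to itself and yet have norm 1.\<close>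
  have disj: "set us \<inter> set (concat uss) = {}"
    using cross us by (force simp: orthonormal_def)
  then show ?case
    using us IH cross unfolding orthonormal_def
    by (auto simp del: set_concat)
qed

text \<open>Pairing positions by \<open>list_all2\<close> tells which basis the \<open>k\<close>-th
  vector of the concatenation comes from, without any computation of offsets.\<close>

lemma list_all2_concat_replicate:
  assumes "\<And>j. j \<in> set js \<Longrightarrow> length (U j) = m j"
    and "\<And>j u. j \<in> set js \<Longrightarrow> u \<in> set (U j) \<Longrightarrow> R u j"
  shows "list_all2 R (concat (map U js)) (concat (map (\<lambda>j. replicate (m j) j) js))"
  using assms
proof (induction js)
  case (Cons j js)
  have "list_all2 R (U j) (replicate (m j) j)"
    using Cons.prems by (simp add: list_all2_conv_all_nth)
  with Cons show ?case by (simp add: list_all2_appendI)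
qed simp

lemma flag_map_orthogonal_group_surj:
  assumes q: "sum_list q = n" and P: "P \<in> flags n q"
  shows "\<exists>Q\<in>orthogonal_group n. flag_map q Q = P"
proof -
  let ?r = "length q"
  have Pc: "P ! i \<in> carrier_mat n n" and Pid: "P ! i * P ! i = P ! i"
    and Pt: "transpose_mat (P ! i) = P ! i" and Pr: "vec_space.rank n (P ! i) = q ! i"
    if "i < ?r" for i
    using P that by (auto simp: flags_def)
  have P0: "P ! i * P ! j = 0\<^sub>m n n" if "i < ?r" "j < ?r" "i \<noteq> j" for i j
    using P that by (auto simp: flags_def)
  have "\<exists>us. length us = q ! i \<and> orthonormal us \<and> set us \<subseteq> (\<lambda>v. P ! i *\<^sub>v v) ` carrier_vec n"
    if "i < ?r" for i
    using orthonormal_list_in_span_cols[OF Pc[OF that]] Pr[OF that] by metis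
  then obtain U where U: "length (U i) = q ! i" "orthonormal (U i)"
    "set (U i) \<subseteq> (\<lambda>v. P ! i *\<^sub>v v) ` carrier_vec n" if "i < ?r" for i
    by metis
  have Uc: "u \<in> carrier_vec n" if "i < ?r" "u \<in> set (U i)" for i u
    using U(3)[OF that(1)] that(2) Pc[OF that(1)] by auto
  \<comment> \<open>Writing \<open>u\<close> as \<open>P ! j *\<^sub>v v\<close> reduces the claim
    to the product \<open>P ! i * P ! j\<close>, which is \<open>P ! j\<close> or zero.\<close>
  have Pu: "P ! i *\<^sub>v u = (if i = j then u else 0\<^sub>v n)"
    if ij: "i < ?r" "j < ?r" "u \<in> set (U j)" for i j u
  proof -
    obtain v where v: "v \<in> carrier_vec n" "u = P ! j *\<^sub>v v" using U(3)[OF ij(2)] ij(3) by blast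
    have "P ! i *\<^sub>v u = (P ! i * P ! j) *\<^sub>v v"
      using v Pc[OF ij(1)] Pc[OF ij(2)] by (simp add: assoc_mult_mat_vec[of _ n n _ n])
    also have "\<dots> = (if i = j then u else 0\<^sub>v n)"
      using Pid[OF ij(1)] P0[OF ij(1,2)] v by auto
    finally show ?thesis .
  qed
  have orth: "u \<bullet> v = 0"
    if ij: "i < ?r" "j < ?r" "i \<noteq> j" and uv: "u \<in> set (U i)" "v \<in> set (U j)" for i j u v
  proof -
    note c = Pc[OF ij(1)] Uc[OF ij(1) uv(1)] Uc[OF ij(2) uv(2)]
    \<comment> \<open>Symmetry moves \<open>P ! i\<close>, which fixes \<open>u\<close>, over to
      \<open>v\<close>, which it kills.\<close>
    have "u \<bullet> v = (P ! i *\<^sub>v u) \<bullet> v" using Pu[OF ij(1) ij(1) uv(1)] by simp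
    also have "\<dots> = u \<bullet> (P ! i *\<^sub>v v)"
      using c Pt[OF ij(1)] transpose_vec_mult_scalar[of "P ! i" n n v u]
      by (simp add: comm_scalar_prod[of _ n])
    also have "\<dots> = 0" using Pu[OF ij(1) ij(2) uv(2)] ij(3) c by simp
    finally show ?thesis .
  qed
  define us where "us = concat (map U [0..<?r])"
  have on: "orthonormal us"
    unfolding us_def by (rule orthonormal_concat) (auto simp: U(2) orth)
  have usc: "set us \<subseteq> carrier_vec n" using Uc by (auto simp: us_def)
  have all2: "list_all2 (\<lambda>u j. j < ?r \<and> u \<in> set (U j)) us (block_of q)"
    unfolding us_def block_of_def by (rule list_all2_concat_replicate) (auto simp: U(1))
  then have len: "length us = n"
    using q by (simp add: list_all2_lengthD length_block_of)
  have us_nth: "block_of q ! k < ?r" "us ! k \<in> set (U (block_of q ! k))" if "k < n" for k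
    using list_all2_nthD[OF all2] that len by auto
  define Q where "Q = mat_of_cols n us"
  have Qc: "Q \<in> carrier_mat n n" "transpose_mat Q \<in> carrier_mat n n"
    using mat_of_cols_carrier(1)[of n us] len by (simp_all add: Q_def)
  have Qo: "Q \<in> orthogonal_group n"
    using orthogonal_groupI[OF Qc(1)] orthonormal_mat_of_cols[OF on usc] len by (simp add: Q_def)
  then have QQ: "Q * transpose_mat Q = 1\<^sub>m n" by (simp add: orthogonal_group_def)
  have colQ: "col Q k = us ! k" if "k < n" for k
    using that len usc by (simp add: Q_def subset_iff)
  have "Q * standard_proj q i * transpose_mat Q = P ! i" if i: "i < ?r" for i
  proof -
    have "P ! i * Q = Q * standard_proj q i"
    proof (rule mat_col_eqI)
      fix k assume "k < dim_col (Q * standard_proj q i)"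
      then have k: "k < n" using q by (simp add: standard_proj_eq_mat_diag mat_diag_def)
      have "col (P ! i * Q) k = P ! i *\<^sub>v us ! k"
        using col_mult2[OF Pc[OF i] Qc(1) k] colQ[OF k] by simp
      \<comment> \<open>Position \<open>k\<close> lies in block \<open>i\<close> exactly when its
        label, which names the basis containing \<open>us ! k\<close>, is \<open>i\<close>.\<close>
      also have "\<dots> = (if k \<in> block_set q i then us ! k else 0\<^sub>v n)"
        using Pu[OF i us_nth[OF k]] k q by (auto simp: block_set_def)
      also have "\<dots> = col (Q * standard_proj q i) k"
        unfolding standard_proj_eq_mat_diag q mat_diag_mult_right[OF Qc(1)] colQ[OF k, symmetric]
        using k Qc(1) by (intro eq_vecI) auto
      finally show "col (P ! i * Q) k = col (Q * standard_proj q i) k" .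
    qed (use Pc[OF i] Qc q in \<open>auto simp: standard_proj_eq_mat_diag mat_diag_def\<close>)
    then have "Q * standard_proj q i * transpose_mat Q = P ! i * Q * transpose_mat Q" by simp
    also have "\<dots> = P ! i"
      using Pc[OF i] Qc QQ by (simp add: assoc_mult_mat[of _ n n _ n _ n])
    finally show ?thesis .
  qed
  moreover have "length P = ?r" using P by (simp add: flags_def)
  ultimately have "flag_map q Q = P"
    by (intro nth_equalityI) (auto simp: flag_map_def)
  with Qo show ?thesis by blast
qed

section \<open>Correcting the determinant\<close>

lemma flag_map_special_orthogonal:
  assumes q: "sum_list q = n" and n: "0 < n" and Q: "Q \<in> orthogonal_group n"
  shows "\<exists>R\<in>special_orthogonal_group n. flag_map q R = flag_map q Q"
proof (cases "det Q = 1")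
  case True
  with Q show ?thesis by (auto simp: special_orthogonal_group_def)
next
  case False
  then have dQ: "det Q = - 1" using det_orthogonal_group[OF Q] by simp
  \<comment> \<open>Right multiplication by \<open>E\<close> negates the first column of
    \<open>Q\<close>.\<close>
  define E :: "real mat" where "E = mat_diag n (\<lambda>k. if k = 0 then - 1 else 1)"
  have Ec: "E \<in> carrier_mat n n" and Et: "transpose_mat E = E" by (simp_all add: E_def)
  have EE: "E * E = 1\<^sub>m n"
    unfolding E_def mat_diag_diag by (intro eq_matI) (auto simp: mat_diag_def)
  have Qc: "Q \<in> carrier_mat n n" "transpose_mat Q \<in> carrier_mat n n"
    and QQ: "transpose_mat Q * Q = 1\<^sub>m n"
    using Q by (auto simp: orthogonal_group_def)
  \<comment> \<open>As an elementary matrix scaling row 0, \<open>E\<close> has a known determinant;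
    row 0 exists because \<open>n\<close> is positive.\<close>
  have "E = multrow_mat n 0 (- 1)"
    by (intro eq_matI) (auto simp: E_def mat_diag_def)
  then have dE: "det E = - 1" using det_multrow_mat[OF n] by simp
  define R where "R = Q * E"
  have Rc: "R \<in> carrier_mat n n" using Qc Ec by (auto simp: R_def)
  have Rt: "transpose_mat R = E * transpose_mat Q"
    using Qc Ec Et by (simp add: R_def transpose_mult[of _ n n _ n])
  have "transpose_mat R * R = E * E"
    using mult_cancel_middle[OF Ec Qc(2,1) Ec QQ] by (simp only: Rt R_def[symmetric])
  then have "R \<in> orthogonal_group n" using orthogonal_groupI[OF Rc] EE by simp
  moreover have "det R = 1" using det_mult[OF Qc(1) Ec] dQ dE by (simp add: R_def)
  moreover have "flag_map q R = flag_map q Q"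
  proof -
    have "R * standard_proj q i * transpose_mat R = Q * standard_proj q i * transpose_mat Q" for i
    proof -
      have S: "standard_proj q i \<in> carrier_mat n n" using q by auto
      \<comment> \<open>Both matrices are diagonal. Moving \<open>E\<close> past the projection
        brings it next to the \<open>E\<close> in \<open>transpose_mat R\<close>, and the two
        cancel.\<close>
      have "E * standard_proj q i = standard_proj q i * E"
        unfolding E_def standard_proj_eq_mat_diag q by (simp add: mult.commute)
      then have "R * standard_proj q i = (Q * standard_proj q i) * E"
        using Qc Ec S by (simp add: R_def assoc_mult_mat[of _ n n _ n _ n])
      then show ?thesis
        unfolding Rt using mult_cancel_middle[OF _ Ec Ec Qc(2) EE, of "Q * standard_proj q i"] Qc S
        by simp
    qed
    then show ?thesis by (simp add: flag_map_def)
  qed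
  ultimately show ?thesis by (auto simp: special_orthogonal_group_def)
qed

theorem corollary3:
  fixes n :: nat and q :: "nat list"
  assumes "flag_type n q"
  shows "flag_map q ` orthogonal_group n = flags n q
    \<and> flag_map q ` special_orthogonal_group n = flags n q"
proof -
  have q: "sum_list q = n" and len: "2 \<le> length q" and pos: "\<forall>i<length q. 0 < q ! i"
    using assms by (auto simp: flag_type_def)
  \<comment> \<open>The first block is nonempty, hence \<open>n\<close> is positive and there is a
    column to negate.\<close>
  have "0 < length q" using len by linarith
  then have "0 < q ! 0" "q ! 0 \<in> set q" using pos nth_mem by blast+
  then have n: "0 < n" using q member_le_sum_list[of "q ! 0" q] by simp
  have O: "flag_map q ` orthogonal_group n = flags n q"
    using flag_map_mem_flags[OF q] flag_map_orthogonal_group_surj[OF q] by blast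
  have SO: "special_orthogonal_group n \<subseteq> orthogonal_group n"
    by (auto simp: special_orthogonal_group_def)
  have "flag_map q ` orthogonal_group n \<subseteq> flag_map q ` special_orthogonal_group n"
  proof (rule image_subsetI)
    fix Q assume "Q \<in> orthogonal_group n"
    then obtain R where "R \<in> special_orthogonal_group n" "flag_map q R = flag_map q Q"
      using flag_map_special_orthogonal[OF q n] by blast
    then show "flag_map q Q \<in> flag_map q ` special_orthogonal_group n"
      by (metis imageI)
  qed
  with O SO show ?thesis by blast
qed

end
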